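(* Let $\eta=\sqrt{2\log(1+z)-\frac{2z}{1+z}}=z-\frac23z^2+\cdots$ and for $m\ge1$ let $$E^{(m)}=\sum_{j=2m}^{\infty}\left([z^j]\,\eta^{2m}\right)j\,u^{j-2m}\frac{\partial}{\partial q_j}.$$ Let $$\widetilde M=M_0+4u^{-1}M_{-1}+6u^{-2}M_{-2}+4u^{-3}M_{-3}+u^{-4}M_{-4}-\frac43u^{-3}L_0-u^{-4}L_{-1}+\frac14u^{-2}q_2+\frac13u^{-3}q_3+\frac18u^{-4}q_4 .$$ Then for all $m\ge1$, $$V_{m-2}^{(H)}=-\frac12\left[\widetilde M-\frac13u^{-2}\frac{\partial}{\partial u},\ u^{2m}E^{(m)}\right],$$ where the operators $V^{(H)}_{m-2}$, $L_k$, $M_k$ are defined in the context.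
   Context: $[z^i]F$ denotes the coefficient of $z^i$ in the series $F$. Operators act on formal series in $u$ and $q_1,q_2,\dots$; $[A,B]=AB-BA$. For $m\in\mathbb Z$, the Virasoro operator is $$L_m=\sum_{k>0,\,k+m>0}(k+m)q_k\frac{\partial}{\partial q_{k+m}}+\frac12\sum_{a,b>0,\,a+b=m}ab\frac{\partial^2}{\partial q_a\partial q_b}+\frac12\sum_{i,j>0,\,i+j=-m}q_iq_j,$$ and for $k\le0$ the cut-and-join type operator is $$M_k=\frac12\sum_{\substack{i,j>0\\i+j+k>0}}(i+j+k)q_iq_j\frac{\partial}{\partial q_{i+j+k}}+\frac12\sum_{\substack{i,j>0\\i+j-k>0}}ij\,q_{i+j-k}\frac{\partial^2}{\partial q_i\partial q_j}+\frac16\sum_{\substack{i,j>0\\-k-i-j>0}}q_iq_jq_{-k-i-j}.$$ For $m\ge-1$ write $\frac{(1+z)^2}{z^2}\eta^{2m+2}=\sum_{i\ge2m}\nu_i^{(m)}z^i$ and $-\frac{z}{1+z}\eta^{2m+2}=\sum_{j\ge2m+2}\gamma_j^{(m)}z^j$. Then $$V_m^{(H)}=\sum_{i=2m}^{\infty}\nu_i^{(m)}u^{i-2m}L_i+\sum_{j=2m+3}^{\infty}\gamma_j^{(m)}ju^{j-2m-3}\frac{\partial}{\partial q_j}-\frac{u^2}{24}\delta_{m,-1}+\frac18\delta_{m,0}.$$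
   Formalization: The prefactor -1/2 is replaced by -u^{4-2m}/(2m); with -1/2 the identity fails for every m≥1, since the right side then has leading term m u^{2m-4} L_{2m-4} instead of L_{2m-4} (for m=2, applied to 1, the constant coefficients are 1/4 and 1/8). *)

theory Defs
  imports
    "HOL-Computational_Algebra.Computational_Algebra"
    "HOL-Library.Poly_Mapping"
    "HOL-Library.Function_Algebras"
begin

(* A formal series in u and the q_i is its coefficient function: F n a is the coefficient of
   u^n * (prod_i q_i^(a i)).  The variables are indexed by int so that the subscripts i+j+k etc.
   below are computed without truncation; membership in the carrier restricts them to q_1, q_2, ... *)

type_synonym mono = "int \<Rightarrow>\<^sub>0 nat"
type_synonym 'a ser = "int \<Rightarrow> mono \<Rightarrow> 'a"

definition series_from :: "int \<Rightarrow> 'a::zero ser set" where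
  "series_from N = {F. (\<forall>n \<alpha>. n < N \<longrightarrow> F n \<alpha> = 0) \<and>
                       (\<forall>n \<alpha>. \<not> Poly_Mapping.keys \<alpha> \<subseteq> {0<..} \<longrightarrow> F n \<alpha> = 0)}"

(* K[[q_1,q_2,...]]((u)).  The order in u is bounded below uniformly in the q-monomials: this is what
   makes the operator sums over unboundedly growing powers of u well defined. *)
definition series :: "'a::zero ser set" where
  "series = (\<Union>N. series_from N)"

definition upow :: "int \<Rightarrow> 'a ser \<Rightarrow> 'a ser" where
  "upow k F = (\<lambda>n \<alpha>. F (n - k) \<alpha>)"

definition du :: "'a::ring_1 ser \<Rightarrow> 'a ser" where
  "du F = (\<lambda>n \<alpha>. of_int (n + 1) * F (n + 1) \<alpha>)"

definition q :: "int \<Rightarrow> 'a::zero ser \<Rightarrow> 'a ser" where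
  "q i F = (\<lambda>n \<alpha>. if Poly_Mapping.lookup \<alpha> i = 0 then 0
                    else F n (\<alpha> - Poly_Mapping.single i 1))"

definition dq :: "int \<Rightarrow> 'a::semiring_1 ser \<Rightarrow> 'a ser" where
  "dq i F = (\<lambda>n \<alpha>. of_nat (Poly_Mapping.lookup \<alpha> i + 1) * F n (\<alpha> + Poly_Mapping.single i 1))"

(* Sums and differences of operators are the pointwise ones of Function_Algebras; the product of
   operators is composition (never the pointwise product). *)

definition scale_op :: "'a::times \<Rightarrow> ('a ser \<Rightarrow> 'a ser) \<Rightarrow> 'a ser \<Rightarrow> 'a ser" (infixr \<open>\<odot>\<close> 70) where
  "(c \<odot> A) F = (\<lambda>n \<alpha>. c * A F n \<alpha>)"

definition commutator :: "('a::ab_group_add ser \<Rightarrow> 'a ser) \<Rightarrow> ('a ser \<Rightarrow> 'a ser) \<Rightarrow> 'a ser \<Rightarrow> 'a ser"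
    (\<open>\<lbrakk>_, _\<rbrakk>\<close>) where
  "\<lbrakk>A, B\<rbrakk> = (A \<circ> B) - (B \<circ> A)"

(* Coefficientwise sum of a family of operators.  sum' adds up the nonzero terms and is 0 if there are
   infinitely many of them; the finite_support lemmas below show that this never happens here. *)
definition sum_op :: "'i set \<Rightarrow> ('i \<Rightarrow> 'a::comm_monoid_add ser \<Rightarrow> 'a ser) \<Rightarrow> 'a ser \<Rightarrow> 'a ser" where
  "sum_op I T F = (\<lambda>n \<alpha>. sum' (\<lambda>i. T i F n \<alpha>) I)"

definition L :: "int \<Rightarrow> 'a::field_char_0 ser \<Rightarrow> 'a ser" where
  "L m = sum_op {k. k > 0 \<and> k + m > 0} (\<lambda>k. of_int (k + m) \<odot> (q k \<circ> dq (k + m)))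
       + (1/2) \<odot> sum_op {(a, b). a > 0 \<and> b > 0 \<and> a + b = m} (\<lambda>(a, b). of_int (a * b) \<odot> (dq a \<circ> dq b))
       + (1/2) \<odot> sum_op {(i, j). i > 0 \<and> j > 0 \<and> i + j = - m} (\<lambda>(i, j). q i \<circ> q j)"

definition M :: "int \<Rightarrow> 'a::field_char_0 ser \<Rightarrow> 'a ser" where
  "M k = (1/2) \<odot> sum_op {(i, j). i > 0 \<and> j > 0 \<and> i + j + k > 0}
           (\<lambda>(i, j). of_int (i + j + k) \<odot> (q i \<circ> q j \<circ> dq (i + j + k)))
       + (1/2) \<odot> sum_op {(i, j). i > 0 \<and> j > 0 \<and> i + j - k > 0}
           (\<lambda>(i, j). of_int (i * j) \<odot> (q (i + j - k) \<circ> dq i \<circ> dq j))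
       + (1/6) \<odot> sum_op {(i, j). i > 0 \<and> j > 0 \<and> - k - i - j > 0}
           (\<lambda>(i, j). q i \<circ> q j \<circ> q (- k - i - j))"

definition eta :: "'a::field_char_0 fps" where
  "eta = (THE f. f\<^sup>2 = 2 * fps_ln 1 - 2 * fps_X / (1 + fps_X) \<and> fps_nth f 1 = 1)"

lemma eta_exists_unique:
  "\<exists>!f :: 'a::field_char_0 fps. f\<^sup>2 = 2 * fps_ln 1 - 2 * fps_X / (1 + fps_X) \<and> fps_nth f 1 = 1"
proof -
  let ?a = "2 * fps_ln 1 - 2 * fps_X / (1 + fps_X) :: 'a fps"
  have inv: "inverse (1 + fps_X :: 'a fps) = Abs_fps (\<lambda>n. (- 1) ^ n)"
    by (rule fps_inverse_fps_X_plus1)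
  have q: "2 * fps_X / (1 + fps_X) = (2 * fps_X * inverse (1 + fps_X) :: 'a fps)"
    by (simp add: fps_divide_unit)
  have eq2: "(2 * fps_X * g :: 'a fps) = fps_const 2 * (fps_X * g)" for g
    by (simp add: numeral_fps_const mult.assoc)
  have num: "(2 * g :: 'a fps) = fps_const 2 * g" for g
    by (simp add: numeral_fps_const)
  have nth: "fps_nth ?a n = 2 * fps_nth (fps_ln 1) n - 2 * (if n = 0 then 0 else (- 1) ^ (n - 1))" for n
    unfolding q inv eq2 num[of "fps_ln 1"] by (simp add: fps_X_mult_nth)
  define b where "b = fps_shift 2 ?a"
  have a0: "fps_nth ?a 0 = 0" and a1: "fps_nth ?a 1 = 0" and a2: "fps_nth ?a 2 = 1"
    unfolding nth by (simp_all add: fps_ln_nth)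
  have b0: "fps_nth b 0 = 1" using a2 by (simp only: b_def fps_shift_nth add_0)
  have ab: "?a = fps_X ^ 2 * b"
  proof (rule fps_ext)
    fix n show "fps_nth ?a n = fps_nth (fps_X ^ 2 * b) n"
    proof (cases "n < 2")
      case True
      then have "n = 0 \<or> n = 1" by auto
      then show ?thesis using a0 a1 by (auto simp only: fps_X_power_mult_nth) auto
    next
      case False
      then have e: "n - 2 + 2 = n" by simp
      then show ?thesis using False unfolding fps_X_power_mult_nth b_def fps_shift_nth e by simp
    qed
  qed
  define r where "r = fps_radical (\<lambda>_ _. 1) 2 b"
  have r2: "r\<^sup>2 = b"
    using power_radical[of b "\<lambda>_ _. 1" 1] b0 by (simp add: r_def numeral_2_eq_2)
  have r0: "fps_nth r 0 = 1" by (simp add: r_def)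
  show ?thesis
  proof (rule ex1I[of _ "fps_X * r"])
    show "(fps_X * r)\<^sup>2 = ?a \<and> fps_nth (fps_X * r) 1 = 1"
      unfolding ab by (simp add: power_mult_distrib r2 r0)
  next
    fix f assume f: "f\<^sup>2 = ?a \<and> fps_nth f 1 = 1"
    then have "f\<^sup>2 = (fps_X * r)\<^sup>2" unfolding ab by (simp add: power_mult_distrib r2)
    then have "f = fps_X * r \<or> f = - (fps_X * r)" by (simp only: power2_eq_iff)
    moreover have "f \<noteq> - (fps_X * r)"
    proof
      assume "f = - (fps_X * r)"
      then have "fps_nth f 1 = -1" by (simp add: r0)
      with f have "(1::'a) = -1" by simp
      then show False by simp
    qed
    ultimately show "f = fps_X * r" by blast
  qed
qed

lemma eta_square: "(eta :: 'a::field_char_0 fps)\<^sup>2 = 2 * fps_ln 1 - 2 * fps_X / (1 + fps_X)"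
  and eta_nth_1: "fps_nth (eta :: 'a fps) 1 = 1"
  using theI'[OF eta_exists_unique] unfolding eta_def by blast+

definition nu :: "int \<Rightarrow> int \<Rightarrow> 'a::field_char_0" where
  "nu m i = fls_nth ((1 + fls_X)\<^sup>2 / fls_X\<^sup>2 * fps_to_fls eta powi (2 * m + 2)) i"

definition gamma :: "int \<Rightarrow> int \<Rightarrow> 'a::field_char_0" where
  "gamma m j = fls_nth (- (fls_X / (1 + fls_X)) * fps_to_fls eta powi (2 * m + 2)) j"

definition V :: "int \<Rightarrow> 'a::field_char_0 ser \<Rightarrow> 'a ser" where
  "V m = sum_op {2 * m..} (\<lambda>i. nu m i \<odot> (upow (i - 2 * m) \<circ> L i))
       + sum_op {2 * m + 3..} (\<lambda>j. (gamma m j * of_int j) \<odot> (upow (j - 2 * m - 3) \<circ> dq j))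
       - (if m = -1 then 1/24 else 0) \<odot> upow 2
       + (if m = 0 then 1/8 else 0) \<odot> id"

definition E :: "nat \<Rightarrow> 'a::field_char_0 ser \<Rightarrow> 'a ser" where
  "E m = sum_op {2 * int m..}
           (\<lambda>j. (fps_nth (eta ^ (2 * m)) (nat j) * of_int j) \<odot> (upow (j - 2 * int m) \<circ> dq j))"

definition Mtilde :: "'a::field_char_0 ser \<Rightarrow> 'a ser" where
  "Mtilde = M 0 + 4 \<odot> (upow (-1) \<circ> M (-1)) + 6 \<odot> (upow (-2) \<circ> M (-2))
          + 4 \<odot> (upow (-3) \<circ> M (-3)) + (upow (-4) \<circ> M (-4))
          - (4/3) \<odot> (upow (-3) \<circ> L 0) - (upow (-4) \<circ> L (-1))
          + (1/4) \<odot> (upow (-2) \<circ> q 2) + (1/3) \<odot> (upow (-3) \<circ> q 3) + (1/8) \<odot> (upow (-4) \<circ> q 4)"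

lemma series_from_mono: "N' \<le> N \<Longrightarrow> series_from N \<subseteq> series_from N'"
  by (auto simp: series_from_def)

lemma q_series_from:
  assumes "F \<in> series_from N" "0 < i" shows "q i F \<in> series_from N"
proof -
  have "\<not> Poly_Mapping.keys (\<alpha> - Poly_Mapping.single i 1) \<subseteq> {0<..}"
    if "\<not> Poly_Mapping.keys \<alpha> \<subseteq> {0<..}" for \<alpha> :: mono
  proof -
    obtain x where x: "x \<in> Poly_Mapping.keys \<alpha>" "\<not> 0 < x" using \<open>\<not> Poly_Mapping.keys \<alpha> \<subseteq> {0<..}\<close> by auto
    then have "Poly_Mapping.lookup (\<alpha> - Poly_Mapping.single i 1) x = Poly_Mapping.lookup \<alpha> x"
      using assms(2) by (auto simp: lookup_minus lookup_single when_def)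
    then have "x \<in> Poly_Mapping.keys (\<alpha> - Poly_Mapping.single i 1)"
      using x by (simp add: in_keys_iff)
    then show ?thesis using x by auto
  qed
  then show ?thesis using assms by (auto simp: series_from_def q_def)
qed

lemma dq_series_from:
  assumes "F \<in> series_from N" shows "dq i F \<in> series_from N"
proof -
  have "\<not> Poly_Mapping.keys (\<alpha> + Poly_Mapping.single i 1) \<subseteq> {0<..}"
    if "\<not> Poly_Mapping.keys \<alpha> \<subseteq> {0<..}" for \<alpha> :: mono
  proof -
    obtain x where x: "x \<in> Poly_Mapping.keys \<alpha>" "\<not> 0 < x" using \<open>\<not> Poly_Mapping.keys \<alpha> \<subseteq> {0<..}\<close> by auto
    then have "x \<in> Poly_Mapping.keys (\<alpha> + Poly_Mapping.single i 1)"
      by (simp add: in_keys_iff lookup_add)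
    then show ?thesis using x by auto
  qed
  then show ?thesis using assms by (auto simp: series_from_def dq_def)
qed

lemma upow_series_from: "F \<in> series_from N \<Longrightarrow> upow k F \<in> series_from (N + k)"
  by (auto simp: series_from_def upow_def)

lemma du_series_from: "F \<in> series_from N \<Longrightarrow> du F \<in> series_from (N - 1)"
  by (auto simp: series_from_def du_def)

lemma scale_op_series_from:
  "A F \<in> series_from N \<Longrightarrow> (c \<odot> A) F \<in> series_from N" for c :: "'a::semiring_0"
  by (auto simp: series_from_def scale_op_def)

lemma add_series_from:
  "A \<in> series_from N \<Longrightarrow> B \<in> series_from N \<Longrightarrow> A + B \<in> series_from N" for A :: "'a::monoid_add ser"
  by (auto simp: series_from_def)

lemma diff_series_from:
  "A \<in> series_from N \<Longrightarrow> B \<in> series_from N \<Longrightarrow> A - B \<in> series_from N" for A :: "'a::group_add ser"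
  by (auto simp: series_from_def)

lemma sum_op_series_from:
  assumes "\<And>i. i \<in> I \<Longrightarrow> T i F \<in> series_from N" shows "sum_op I T F \<in> series_from N"
proof -
  have "sum_op I T F n \<alpha> = 0" if "\<And>i. i \<in> I \<Longrightarrow> T i F n \<alpha> = 0" for n \<alpha>
    unfolding sum_op_def sum.G_def using that by (auto intro!: sum.neutral)
  then show ?thesis using assms by (auto simp: series_from_def)
qed

lemma op_apply:
  fixes A B :: "'a::ab_group_add ser \<Rightarrow> 'a ser"
  shows "(A + B) F = A F + B F" and "(A - B) F = A F - B F"
  by simp_all

lemmas series_from_intros = q_series_from dq_series_from scale_op_series_from add_series_from
  diff_series_from sum_op_series_from

lemma L_series_from: "F \<in> series_from N \<Longrightarrow> L m F \<in> series_from N"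
  unfolding L_def op_apply
  by (intro series_from_intros; auto intro!: series_from_intros)

lemma M_series_from: "F \<in> series_from N \<Longrightarrow> M k F \<in> series_from N"
  unfolding M_def op_apply
  by (intro series_from_intros; auto intro!: series_from_intros)

lemma upow_series_from_ge:
  "F \<in> series_from N \<Longrightarrow> N' \<le> N + k \<Longrightarrow> upow k F \<in> series_from N'"
  using upow_series_from series_from_mono by blast

lemma E_series_from: "F \<in> series_from N \<Longrightarrow> E m F \<in> series_from N"
  unfolding E_def by (intro series_from_intros) (auto intro!: upow_series_from_ge dq_series_from)

lemma V_series_from: "F \<in> series_from N \<Longrightarrow> V m F \<in> series_from N"
  unfolding V_def op_apply
  by (intro series_from_intros)
    (auto intro!: upow_series_from_ge[of _ N] dq_series_from L_series_from)

lemma Mtilde_series_from: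
  assumes F: "F \<in> series_from N" shows "Mtilde F \<in> series_from (N - 4)"
proof -
  have "F \<in> series_from (N - 4)" using F series_from_mono[of "N - 4" N] by auto
  then show ?thesis
    unfolding Mtilde_def op_apply comp_apply using F
    by (intro series_from_intros)
      (auto intro!: upow_series_from_ge[of _ N] q_series_from L_series_from M_series_from)
qed

lemma L_finite_support:
  fixes F :: "'a::field_char_0 ser"
  shows "finite {k \<in> {k. k > 0 \<and> k + m > 0}. (of_int (k + m) \<odot> (q k \<circ> dq (k + m))) F n \<alpha> \<noteq> 0}"
    and "finite {(a, b). a > 0 \<and> b > 0 \<and> a + b = (m::int)}"
    and "finite {(i, j). i > 0 \<and> j > 0 \<and> i + j = - (m::int)}"
proof -
  show "finite {k \<in> {k. k > 0 \<and> k + m > 0}. (of_int (k + m) \<odot> (q k \<circ> dq (k + m))) F n \<alpha> \<noteq> 0}"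
    by (rule finite_subset[OF _ finite_keys[of \<alpha>]])
      (auto simp: scale_op_def q_def in_keys_iff split: if_splits)
  have "finite {(a, b). a > 0 \<and> b > 0 \<and> a + b = (s::int)}" for s
    by (rule finite_subset[of _ "{0..s} \<times> {0..s}"]) auto
  then show "finite {(a, b). a > 0 \<and> b > 0 \<and> a + b = (m::int)}"
    "finite {(i, j). i > 0 \<and> j > 0 \<and> i + j = - (m::int)}" by blast+
qed

lemma M_finite_support:
  fixes F :: "'a::field_char_0 ser"
  shows "finite {p \<in> {(i, j). i > 0 \<and> j > 0 \<and> i + j + k > 0}.
           (case p of (i, j) \<Rightarrow> of_int (i + j + k) \<odot> (q i \<circ> q j \<circ> dq (i + j + k))) F n \<alpha> \<noteq> 0}"
    and "finite {p \<in> {(i, j). i > 0 \<and> j > 0 \<and> i + j - k > 0}.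
           (case p of (i, j) \<Rightarrow> of_int (i * j) \<odot> (q (i + j - k) \<circ> dq i \<circ> dq j)) F n \<alpha> \<noteq> 0}"
    and "finite {(i, j). i > 0 \<and> j > 0 \<and> - k - i - j > (0::int)}"
proof -
  show "finite {p \<in> {(i, j). i > 0 \<and> j > 0 \<and> i + j + k > 0}.
           (case p of (i, j) \<Rightarrow> of_int (i + j + k) \<odot> (q i \<circ> q j \<circ> dq (i + j + k))) F n \<alpha> \<noteq> 0}"
    by (rule finite_subset[of _ "Poly_Mapping.keys \<alpha> \<times> Poly_Mapping.keys \<alpha>"])
      (auto simp: scale_op_def q_def in_keys_iff lookup_minus split: if_splits)
  have "finite {(i, j). i > 0 \<and> j > 0 \<and> i + j = (s::int)}" for s
    by (rule finite_subset[of _ "{0..s} \<times> {0..s}"]) auto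
  then have "finite (\<Union>s\<in>Poly_Mapping.keys \<alpha>. {(i, j). i > 0 \<and> j > 0 \<and> i + j = s + k})" by simp
  then show "finite {p \<in> {(i, j). i > 0 \<and> j > 0 \<and> i + j - k > 0}.
           (case p of (i, j) \<Rightarrow> of_int (i * j) \<odot> (q (i + j - k) \<circ> dq i \<circ> dq j)) F n \<alpha> \<noteq> 0}"
    by (rule rev_finite_subset) (force simp: scale_op_def q_def in_keys_iff split: if_splits)
  show "finite {(i, j). i > 0 \<and> j > 0 \<and> - k - i - j > (0::int)}"
    by (rule finite_subset[of _ "{0..-k} \<times> {0..-k}"]) auto
qed

lemma upow_finite_support:
  fixes c :: "int \<Rightarrow> 'a::semiring_0"
  assumes "F \<in> series_from N" "\<And>j. A j F \<in> series_from N"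
  shows "finite {j \<in> {l..}. (c j \<odot> (upow (j - d) \<circ> A j)) F n \<alpha> \<noteq> 0}"
proof (rule finite_subset)
  have "n - (j - d) \<ge> N" if "A j F (n - (j - d)) \<alpha> \<noteq> 0" for j
  proof (rule ccontr)
    assume "\<not> n - (j - d) \<ge> N"
    then have "A j F (n - (j - d)) \<alpha> = 0" using assms(2)[of j] by (auto simp: series_from_def)
    with that show False by simp
  qed
  then have "j \<le> n + d - N" if "(c j \<odot> (upow (j - d) \<circ> A j)) F n \<alpha> \<noteq> 0" for j
  proof -
    have "A j F (n - (j - d)) \<alpha> \<noteq> 0" using that by (auto simp: scale_op_def upow_def)
    then have "n - (j - d) \<ge> N" by (rule \<open>\<And>j. A j F (n - (j - d)) \<alpha> \<noteq> 0 \<Longrightarrow> n - (j - d) \<ge> N\<close>)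
    then show ?thesis by linarith
  qed
  then show "{j \<in> {l..}. (c j \<odot> (upow (j - d) \<circ> A j)) F n \<alpha> \<noteq> 0} \<subseteq> {l..n + d - N}"
    by auto
qed simp

lemma E_finite_support:
  assumes "F \<in> series"
  shows "finite {j \<in> {2 * int m..}.
    ((fps_nth (eta ^ (2 * m)) (nat j) * of_int j) \<odot> (upow (j - 2 * int m) \<circ> dq j)) F n \<alpha> \<noteq> 0}"
  using assms unfolding series_def by (auto intro!: upow_finite_support dq_series_from simp del: atLeast_iff)

lemma V_finite_support:
  assumes "F \<in> series"
  shows "finite {i \<in> {2 * m..}. (nu m i \<odot> (upow (i - 2 * m) \<circ> L i)) F n \<alpha> \<noteq> 0}"
    and "finite {j \<in> {2 * m + 3..}.
      ((gamma m j * of_int j) \<odot> (upow (j - 2 * m - 3) \<circ> dq j)) F n \<alpha> \<noteq> 0}"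
proof -
  obtain N where N: "F \<in> series_from N" using assms by (auto simp: series_def)
  show "finite {i \<in> {2 * m..}. (nu m i \<odot> (upow (i - 2 * m) \<circ> L i)) F n \<alpha> \<noteq> 0}"
    by (rule upow_finite_support[where A = L, OF N L_series_from[OF N]])
  show "finite {j \<in> {2 * m + 3..}. ((gamma m j * of_int j) \<odot> (upow (j - 2 * m - 3) \<circ> dq j)) F n \<alpha> \<noteq> 0}"
    using upow_finite_support[where A = dq, OF N dq_series_from[OF N], where d = "2 * m + 3"]
    by (simp add: diff_diff_eq)
qed

(* Grading: deg u = 1, deg q_i = i.  V m is homogeneous of degree -2 m, while the degree 0 part of
   Mtilde - (1/3) u^(-2) d/du (the M_k- and q_i-terms) has a commutator of degree 0 with u^(2 m) E m;
   so V (m - 2) can only be proportional to u^(4 - 2 m) times the commutator, and comparing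
   L_(m-2)-terms gives the factor - u^(4 - 2 m) / (2 m).  The constant - 1/2 in its place is wrong, and
   not only by a power of u: at m = 2, where u^(4 - 2 m) = 1, it gives 2 V 0 rather than V 0.  The
   lemma evaluates the constant coefficients on the series F = 1. *)
lemma constant_normalization_fails:
  fixes F :: "'a::field_char_0 ser"
  defines "F \<equiv> (\<lambda>n \<alpha>. if n = 0 \<and> \<alpha> = 0 then 1 else 0)"
  shows "F \<in> series"
    and "V 0 F 0 0 = 1/8"
    and "((- 1/2) \<odot> \<lbrakk>Mtilde - (1/3) \<odot> (upow (-2) \<circ> du), upow 4 \<circ> E 2\<rbrakk>) F 0 0 = 1/4"
proof -
  show FS: "F \<in> series"
    unfolding series_def series_from_def F_def by (intro UN_I[of 0]) auto
  have single_nz: "\<alpha> + Poly_Mapping.single i 1 \<noteq> 0" for \<alpha> :: mono and i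
  proof
    assume "\<alpha> + Poly_Mapping.single i 1 = 0"
    then have "Poly_Mapping.lookup (\<alpha> + Poly_Mapping.single i 1) i = 0" by simp
    then show False by (simp add: lookup_add)
  qed
  have dqF: "dq i F = 0" for i
    using single_nz by (auto simp: dq_def F_def fun_eq_iff)
  have dq0: "dq i 0 = (0 :: 'a ser)" and q0: "q i 0 = (0 :: 'a ser)" and u0: "upow i 0 = (0 :: 'a ser)"
    and du0: "du 0 = (0 :: 'a ser)" for i
    by (auto simp: dq_def q_def upow_def du_def fun_eq_iff)
  have sc0: "A G = 0 \<Longrightarrow> (c \<odot> A) G = 0" for A :: "'a ser \<Rightarrow> 'a ser" and c G
    by (auto simp: scale_op_def fun_eq_iff)
  have so0: "(\<And>i. i \<in> I \<Longrightarrow> T i G = 0) \<Longrightarrow> sum_op I T G = 0"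
    for I :: "'i set" and T and G :: "'a ser"
    unfolding sum_op_def sum.G_def by (auto simp: fun_eq_iff intro!: sum.neutral)
  have so0': "(\<And>i. i \<in> I \<Longrightarrow> T i G n \<alpha> = 0) \<Longrightarrow> sum_op I T G n \<alpha> = 0"
    for I :: "'i set" and T n \<alpha> and G :: "'a ser"
    unfolding sum_op_def sum.G_def by (auto intro!: sum.neutral)
  have add0: "A = 0 \<Longrightarrow> B = 0 \<Longrightarrow> A + B = 0" for A B :: "'a ser" by simp
  have LF: "L m F = 0" if "m \<ge> 0" for m
    unfolding L_def op_apply using that
    by (intro add0 sc0 so0) (auto simp: scale_op_def dqF dq0 q0 fun_eq_iff)
  show "V 0 F 0 0 = 1/8"
  proof -
    have "sum_op {2 * 0..} (\<lambda>i. nu 0 i \<odot> (upow (i - 2 * 0) \<circ> L i)) F = 0"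
      by (rule so0) (auto intro!: sc0 simp: LF u0)
    moreover have "sum_op {2 * 0 + 3..} (\<lambda>j. (gamma 0 j * of_int j) \<odot> (upow (j - 2 * 0 - 3) \<circ> dq j)) F = 0"
      by (rule so0) (auto intro!: sc0 simp: dqF u0)
    ultimately show ?thesis
      unfolding V_def op_apply by (simp add: scale_op_def F_def)
  qed

  have eta4: "fps_nth ((eta :: 'a fps) ^ (2 * 2)) 4 = 1"
  proof -
    have "fps_nth ((eta :: 'a fps)\<^sup>2) 0 = 0"
      unfolding eta_square by (simp add: fps_divide_unit)
    then have e0: "fps_nth (eta :: 'a fps) 0 = 0" by (simp add: fps_power_zeroth)
    define h where "h = fps_shift 1 (eta :: 'a fps)"
    have h: "eta = fps_X * h"
      unfolding h_def by (rule fps_ext) (simp add: e0)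
    have h0: "fps_nth h 0 = 1" using eta_nth_1[where ?'a = 'a] by (simp add: h_def)
    have "eta ^ (2 * 2) = fps_X ^ 4 * h ^ 4" unfolding h by (simp add: power_mult_distrib)
    then show ?thesis by (simp add: fps_X_power_mult_nth fps_power_zeroth h0)
  qed

  let ?W = "Mtilde - (1/3) \<odot> (upow (-2) \<circ> du) :: 'a ser \<Rightarrow> 'a ser"
  have EF: "E 2 F = 0" unfolding E_def by (rule so0) (auto intro!: sc0 simp: dqF u0)
  have L0: "L m 0 = (0 :: 'a ser)" for m
    unfolding L_def op_apply by (simp add: so0 sc0 dq0 q0 split_beta)
  have M0: "M m 0 = (0 :: 'a ser)" for m
    unfolding M_def op_apply by (simp add: so0 sc0 dq0 q0 split_beta)
  have W0: "?W 0 = 0"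
    unfolding Mtilde_def op_apply by (simp add: sc0 M0 L0 u0 q0 du0)

  have qq: "q i (q k G) n (Poly_Mapping.single j 1) = 0" for i j k n and G :: "'a ser"
    by (auto simp: q_def lookup_single lookup_minus when_def)
  have add0': "a = 0 \<Longrightarrow> b = 0 \<Longrightarrow> a + b = 0" for a b :: 'a by simp
  have sc0': "A G n \<alpha> = 0 \<Longrightarrow> (c \<odot> A) G n \<alpha> = 0" for A :: "'a ser \<Rightarrow> 'a ser" and c G n \<alpha>
    by (simp add: scale_op_def)
  have L1: "L k F n (Poly_Mapping.single j 1) = 0" for k n j
    unfolding L_def op_apply plus_fun_apply
    by (intro add0' sc0' so0') (auto simp: scale_op_def dqF dq0 q0 qq[unfolded One_nat_def])
  have M1: "M k F n (Poly_Mapping.single j 1) = 0" for k n j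
    unfolding M_def op_apply plus_fun_apply
    by (intro add0' sc0' so0') (auto simp: scale_op_def dqF dq0 q0 qq[unfolded One_nat_def])
  have "of_int (n + 1) * F (n + 1) \<alpha> = 0" for n \<alpha>
    by (cases "n + 1 = 0") (simp_all only: of_int_0 mult_zero_left mult_zero_right F_def if_False simp_thms)
  then have duF: "du F = 0" by (simp only: du_def fun_eq_iff zero_fun_apply simp_thms)
  have W1: "?W F (- j) (Poly_Mapping.single j 1) = (if j = 4 then 1/8 else 0)" if "j \<ge> 4" for j
  proof -
    have "F 0 0 = 1" by (simp add: F_def)
    moreover have "Poly_Mapping.lookup (Poly_Mapping.single j (1::nat)) 2 = 0"
      "Poly_Mapping.lookup (Poly_Mapping.single j (1::nat)) 3 = 0"
      "Poly_Mapping.lookup (Poly_Mapping.single j (1::nat)) 4 = (if j = 4 then 1 else 0)"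
      using that by (auto simp: lookup_single when_def)
    ultimately show ?thesis
      unfolding Mtilde_def op_apply
      by (simp add: scale_op_def L1[unfolded One_nat_def] M1[unfolded One_nat_def] duF u0 upow_def q_def)
  qed
  define G where "G = ?W F"
  have term_eq: "((fps_nth (eta ^ (2 * 2)) (nat j) * of_int j) \<odot> (upow (j - 2 * int 2) \<circ> dq j)) G (- 4) 0
      = (if j = 4 then 1/2 else 0)" if "j \<ge> 4" for j
  proof -
    have "dq j G (- j) 0 = (if j = 4 then 1/8 else 0)"
      using W1[OF that] by (simp add: dq_def G_def)
    then show ?thesis using eta4 by (auto simp: scale_op_def upow_def)
  qed
  have supp: "{j \<in> {4::int..}. (if j = 4 then 1/2 else 0 :: 'a) \<noteq> 0} = {4}" by auto
  have "E 2 G (- 4) 0 = sum' (\<lambda>j. if j = 4 then 1/2 else 0) {4::int..}"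
    unfolding E_def sum_op_def by (rule sum.cong') (use term_eq in auto)
  also have "\<dots> = 1/2" unfolding sum.G_def supp by simp
  finally have "(upow 4 \<circ> E 2) G 0 0 = 1/2" by (simp add: upow_def)
  moreover have "(W \<circ> (upow 4 \<circ> E 2)) F = 0" if "W = ?W" for W
    using W0 by (simp only: that comp_apply EF u0)
  moreover have "((- 1/2) \<odot> \<lbrakk>W, B\<rbrakk>) F 0 0 = - 1/2 * ((W \<circ> B) F 0 0 - B (W F) 0 0)"
    for W B :: "'a ser \<Rightarrow> 'a ser"
    by (simp add: scale_op_def commutator_def)
  ultimately show "((- 1/2) \<odot> \<lbrakk>?W, upow 4 \<circ> E 2\<rbrakk>) F 0 0 = 1/4"
    by (simp only: G_def zero_fun_apply) simp
qed

end

theory Submission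
  imports Defs
begin

text \<open>
  Put \<open>\<alpha>\<^sub>n = n \<partial>/\<partial>q\<^sub>n\<close> and \<open>\<alpha>\<^sub>-\<^sub>n = q\<^sub>n\<close> for \<open>n > 0\<close>. Then \<open>L\<^sub>m\<close> and \<open>M\<^sub>k\<close> are the normally ordered
  quadratic and cubic expressions in the \<open>\<alpha>\<close>'s of total index \<open>m\<close> and \<open>k\<close> (for \<open>M\<^sub>k\<close> without its triple
  derivatives, which commute with \<open>\<alpha>\<^sub>n\<close>), so that \<open>[\<alpha>\<^sub>n, M\<^sub>k] = n L\<^sub>n\<^sub>+\<^sub>k\<close> and
  \<open>[\<alpha>\<^sub>n, L\<^sub>m] = n \<alpha>\<^sub>n\<^sub>+\<^sub>m\<close> for \<open>n, n + m > 0\<close>. With \<open>f = \<eta>\<^sup>2\<^sup>m\<close>, the commutator in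
  question is therefore a sum of terms \<open>L\<^sub>i\<close>, \<open>\<alpha>\<^sub>j\<close> and constants, where, up to powers of \<open>u\<close>, \<open>L\<^sub>i\<close> has the coefficient
  \<open>-[z\<^sup>i] z (1 + 1/z)\<^sup>4 f'\<close> and \<open>\<alpha>\<^sub>j\<close> the coefficient \<open>[z\<^sup>j] (1 + z) f'\<close>. As
  \<open>\<eta> \<eta>' = z / (1 + z)\<^sup>2\<close>, these are multiples of \<open>\<nu>\<^sub>i\<close> and \<open>\<gamma>\<^sub>j\<close>. The infinite sum \<open>E\<close> is handled by
  splitting off a finite part; the operator \<open>Mtilde - (1/3) u\<^sup>-\<^sup>2 d/du\<close> lowers the order in \<open>u\<close> by at
  most \<open>4\<close>, so the rest does not contribute to a given coefficient.
\<close>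

section \<open>Sums of finite support, with default value 0\<close>

lemma sum'_cmult: "sum' (\<lambda>i. c * f i) I = c * sum' f I" for c :: "'a::field"
proof (cases "c = 0")
  case False
  then show ?thesis by (simp add: sum.G_def sum_distrib_left)
qed (simp add: sum.G_def)

lemma sum'_uminus: "sum' (\<lambda>i. - f i) I = - sum' f I" for f :: "'i \<Rightarrow> 'a::field"
  using sum'_cmult[of "-1" f I] by simp

lemma sum'_diff:
  fixes f g :: "'i \<Rightarrow> 'a::field"
  assumes "finite {i \<in> I. f i \<noteq> 0}" "finite {i \<in> I. g i \<noteq> 0}"
  shows "sum' (\<lambda>i. f i - g i) I = sum' f I - sum' g I"
  using sum.distrib'[of I f "\<lambda>i. - g i"] assms by (simp add: sum'_uminus)

text \<open>\<open>h\<close> restricts to a bijection between the support of \<open>g\<close> in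
  \<open>J\<close> and that of \<open>f\<close> in \<open>I\<close>. These are finite together, and
  if they are infinite both sums take the default value 0.\<close>

lemma sum'_reindex:
  assumes "inj_on h J" "h ` J \<subseteq> I" "\<And>i. i \<in> I \<Longrightarrow> f i \<noteq> 0 \<Longrightarrow> i \<in> h ` J" "\<And>j. j \<in> J \<Longrightarrow> f (h j) = g j"
  shows "sum' f I = sum' g J"
proof -
  let ?I = "{i \<in> I. f i \<noteq> 0}" and ?J = "{j \<in> J. g j \<noteq> 0}"
  have inj: "inj_on h ?J" using assms(1) by (rule inj_on_subset) auto
  have im: "h ` ?J = ?I"
  proof
    show "h ` ?J \<subseteq> ?I" using assms(2,4) by auto
    show "?I \<subseteq> h ` ?J"
    proof
      fix i assume "i \<in> ?I"
      then have i: "i \<in> I" "f i \<noteq> 0" by simp_all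
      then obtain j where j: "j \<in> J" "i = h j" using assms(3) by blast
      then have "g j \<noteq> 0" using i assms(4) by force
      then show "i \<in> h ` ?J" using j by blast
    qed
  qed
  have "finite ?I \<longleftrightarrow> finite ?J" unfolding im[symmetric] by (rule finite_image_iff[OF inj])
  moreover have "sum f ?I = sum g ?J"
    unfolding im[symmetric] sum.reindex[OF inj] by (rule sum.cong) (use assms(4) in auto)
  ultimately show ?thesis by (simp add: sum.G_def)
qed

lemma sum'_eq_sum:
  assumes "finite J" "J \<subseteq> I" "\<And>i. i \<in> I - J \<Longrightarrow> f i = 0"
  shows "sum' f I = sum f J"
proof -
  have "sum' f I = sum' f J" by (rule sum'_reindex[where h = id]) (use assms in auto)
  then show ?thesis using assms(1) by (simp add: sum.eq_sum)
qed

section \<open>Linearity of the operators\<close>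

text \<open>Linearity over the coefficient field. It says nothing about infinite sums, which is why
  \<open>E\<close> has to be truncated before \<open>Mtilde\<close> can be moved inside it.\<close>

definition linear_op :: "('a::field_char_0 ser \<Rightarrow> 'a ser) \<Rightarrow> bool" where
  "linear_op A \<longleftrightarrow> (\<forall>F G. A (F + G) = A F + A G) \<and> (\<forall>c F. A (\<lambda>n \<alpha>. c * F n \<alpha>) = (\<lambda>n \<alpha>. c * A F n \<alpha>))"

lemma linear_op_q: "linear_op (q i)"
  by (auto simp: linear_op_def q_def fun_eq_iff)

lemma linear_op_dq: "linear_op (dq i)"
  by (auto simp: linear_op_def dq_def fun_eq_iff algebra_simps)

lemma linear_op_upow: "linear_op (upow i)"
  by (auto simp: linear_op_def upow_def fun_eq_iff)

lemma linear_op_du: "linear_op du"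
  by (auto simp: linear_op_def du_def fun_eq_iff algebra_simps)

lemma linear_op_comp: "linear_op A \<Longrightarrow> linear_op B \<Longrightarrow> linear_op (A \<circ> B)"
  by (simp add: linear_op_def)

lemma linear_op_plus: "linear_op A \<Longrightarrow> linear_op B \<Longrightarrow> linear_op (A + B)"
  by (simp add: linear_op_def fun_eq_iff algebra_simps)

lemma linear_op_minus: "linear_op A \<Longrightarrow> linear_op B \<Longrightarrow> linear_op (A - B)"
  by (simp add: linear_op_def fun_eq_iff algebra_simps)

lemma linear_op_scale: "linear_op A \<Longrightarrow> linear_op (c \<odot> A)"
  by (simp add: linear_op_def scale_op_def fun_eq_iff algebra_simps)

text \<open>\<open>sum'\<close> is additive only on finite supports. The finiteness is asked for
  every coefficient function \<open>F\<close>; in \<open>L\<close> and \<open>M\<close> an infinite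
  sum always carries a factor \<open>q i\<close> on the left, and only finitely many of these divide
  the monomial \<alpha>.\<close>

lemma linear_op_sum_op:
  assumes "\<And>i. i \<in> I \<Longrightarrow> linear_op (T i)" "\<And>F n \<alpha>. finite {i \<in> I. T i F n \<alpha> \<noteq> 0}"
  shows "linear_op (sum_op I T)"
proof -
  have "sum' (\<lambda>i. T i (F + G) n \<alpha>) I = sum' (\<lambda>i. T i F n \<alpha>) I + sum' (\<lambda>i. T i G n \<alpha>) I" for F G n \<alpha>
    unfolding sum.distrib'[OF assms(2) assms(2), symmetric]
    by (rule sum.cong') (use assms(1) in \<open>auto simp: linear_op_def\<close>)
  moreover have "sum' (\<lambda>i. T i (\<lambda>n \<alpha>. c * F n \<alpha>) n \<alpha>) I = c * sum' (\<lambda>i. T i F n \<alpha>) I" for c F n \<alpha>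
    unfolding sum'_cmult[symmetric]
    by (rule sum.cong') (use assms(1) in \<open>auto simp: linear_op_def\<close>)
  ultimately show ?thesis by (simp add: linear_op_def sum_op_def fun_eq_iff)
qed

lemmas linear_op_intros = linear_op_q linear_op_dq linear_op_upow linear_op_du linear_op_comp
  linear_op_plus linear_op_minus linear_op_scale

lemma linear_op_L: "linear_op (L m)"
  unfolding L_def
  by (intro linear_op_plus linear_op_scale linear_op_sum_op L_finite_support(1)
      finite_subset[OF _ L_finite_support(2)[of m]] finite_subset[OF _ L_finite_support(3)[of m]])
    (auto intro!: linear_op_intros)

lemma linear_op_M: "linear_op (M k)"
  unfolding M_def
  by (intro linear_op_plus linear_op_scale linear_op_sum_op M_finite_support(1) M_finite_support(2)
      finite_subset[OF _ M_finite_support(3)[of k]])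
    (auto intro!: linear_op_intros)

lemma linear_op_Mtilde: "linear_op Mtilde"
  unfolding Mtilde_def by (intro linear_op_intros linear_op_M linear_op_L)

lemma linear_op_sum:
  assumes "linear_op A" shows "A (\<Sum>i\<in>I. G i) = (\<Sum>i\<in>I. A (G i))"
proof -
  have "A (\<lambda>n \<alpha>. 0 * F n \<alpha>) = (\<lambda>n \<alpha>. 0 * A F n \<alpha>)" for F :: "'a ser"
    using assms by (simp only: linear_op_def)
  then have "A 0 = 0" by (simp add: zero_fun_def)
  then show ?thesis
    using assms by (induction I rule: infinite_finite_induct) (simp_all add: linear_op_def)
qed

section \<open>Commutators of \<open>L\<close> and \<open>M\<close> with a derivative\<close>

text \<open>The canonical commutation relation. Subtraction of exponents is truncated, so the
  monomial identities are stated where \<open>q i\<close> divides the monomial. Where it does not,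
  both sides are 0 unless \<open>i = l\<close>, in which case \<open>dq l\<close> first raises the
  exponent to 1.\<close>

lemma dq_q: "dq l (q i F) = q i (dq l F) + (if i = l then F else 0)"
  for F :: "'a::field_char_0 ser"
proof (intro ext)
  fix n \<alpha>
  have "\<alpha> + Poly_Mapping.single l 1 - Poly_Mapping.single i 1
      = \<alpha> - Poly_Mapping.single i 1 + Poly_Mapping.single l 1"
    if "Poly_Mapping.lookup \<alpha> i \<noteq> 0" for \<alpha> :: mono
    by (rule poly_mapping_eqI) (use that in \<open>auto simp: lookup_add lookup_minus lookup_single when_def\<close>)
  moreover have "\<alpha> - Poly_Mapping.single i 1 + Poly_Mapping.single i 1 = \<alpha>"
    if "Poly_Mapping.lookup \<alpha> i \<noteq> 0" for \<alpha> :: mono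
    by (rule poly_mapping_eqI) (use that in \<open>auto simp: lookup_add lookup_minus lookup_single when_def\<close>)
  ultimately show "dq l (q i F) n \<alpha> = (q i (dq l F) + (if i = l then F else 0)) n \<alpha>"
    by (auto simp: dq_def q_def lookup_add lookup_minus lookup_single when_def algebra_simps of_nat_diff)
qed

lemma dq_dq: "dq i (dq j F) = dq j (dq i F)" for F :: "'a::field_char_0 ser"
  by (auto simp: dq_def fun_eq_iff lookup_add lookup_single when_def add.commute add.left_commute)

lemma q_q: "q i (q j F) = q j (q i F)" for F :: "'a::field_char_0 ser"
  by (auto simp: q_def fun_eq_iff lookup_minus lookup_single when_def diff_diff_add add.commute)

lemma q_add: "q i (F + G) = q i F + q i G" for F :: "'a::field_char_0 ser"
  using linear_op_q by (auto simp: linear_op_def)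

lemma dq_scale: "dq l ((c \<odot> A) F) = (c \<odot> (\<lambda>F. dq l (A F))) F" for F :: "'a::field_char_0 ser"
  by (auto simp: dq_def scale_op_def fun_eq_iff)

lemma q_0: "q i 0 = 0"
  by (auto simp: q_def fun_eq_iff)

lemma dq_sum_op: "dq l (sum_op I T F) = sum_op I (\<lambda>i F. dq l (T i F)) F" for F :: "'a::field_char_0 ser"
  by (simp add: dq_def sum_op_def fun_eq_iff sum'_cmult)

text \<open>The bracket may be taken term by term, because \<open>dq l\<close> reads a single
  coefficient, the one at \<alpha> with the exponent of \<open>q_l\<close> raised by 1, and there
  too the support is finite.\<close>

lemma sum_op_commutator_dq:
  fixes F :: "'a::field_char_0 ser"
  assumes "\<And>F n \<alpha>. finite {i \<in> I. T i F n \<alpha> \<noteq> 0}"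
  shows "dq l (sum_op I T F) n \<alpha> - sum_op I T (dq l F) n \<alpha>
    = sum' (\<lambda>i. dq l (T i F) n \<alpha> - T i (dq l F) n \<alpha>) I"
  unfolding dq_sum_op
  by (subst sum'_diff) 
    (auto simp: sum_op_def dq_def intro: assms finite_subset[OF _ assms[of F n "\<alpha> + Poly_Mapping.single l 1"]])

lemma op_apply_nth:
  fixes A B :: "'a::ab_group_add ser \<Rightarrow> 'a ser"
  shows "(A + B) F n \<alpha> = A F n \<alpha> + B F n \<alpha>" "(A - B) F n \<alpha> = A F n \<alpha> - B F n \<alpha>"
  by simp_all

lemma scale_op_nth: "(c \<odot> A) F n \<alpha> = c * A F n \<alpha>"
  by (simp add: scale_op_def)

lemma dq_add: "dq l (F + G) = dq l F + dq l G" for F :: "'a::field_char_0 ser"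
  by (simp add: dq_def fun_eq_iff algebra_simps)

text \<open>Only the factor \<open>q k\<close> of the first sum fails to commute with
  \<open>dq l\<close>, which leaves the term \<open>k = l\<close>. The second sum contains
  derivatives only. In the third, \<open>i = l\<close> would force \<open>j = - m - l < 0\<close>,
  and likewise with \<open>i\<close> and \<open>j\<close> exchanged.\<close>

lemma dq_L:
  fixes F :: "'a::field_char_0 ser"
  assumes "l > 0" "l + m > 0"
  shows "dq l (L m F) n \<alpha> - L m (dq l F) n \<alpha> = of_int (l + m) * dq (l + m) F n \<alpha>"
proof -
  let ?I1 = "{k. k > 0 \<and> k + m > 0}" and ?I2 = "{(a, b). a > 0 \<and> b > 0 \<and> a + b = m}"
    and ?I3 = "{(i, j). i > 0 \<and> j > 0 \<and> i + j = - m}"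
  let ?T1 = "\<lambda>k. of_int (k + m) \<odot> (q k \<circ> dq (k + m)) :: 'a ser \<Rightarrow> 'a ser"
    and ?T2 = "\<lambda>(a, b). of_int (a * b) \<odot> (dq a \<circ> dq b) :: 'a ser \<Rightarrow> 'a ser"
    and ?T3 = "\<lambda>(i, j). q i \<circ> q j :: 'a ser \<Rightarrow> 'a ser"
  have "dq l (sum_op ?I1 ?T1 F) n \<alpha> - sum_op ?I1 ?T1 (dq l F) n \<alpha>
      = sum' (\<lambda>k. if k = l then of_int (k + m) * dq (k + m) F n \<alpha> else 0) ?I1"
    by (subst sum_op_commutator_dq[OF L_finite_support(1)], rule sum.cong')
      (auto simp: dq_scale scale_op_nth dq_q dq_dq[of l] algebra_simps)
  also have "\<dots> = of_int (l + m) * dq (l + m) F n \<alpha>"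
    by (subst sum'_eq_sum[where J = "{l}"]) (use assms in auto)
  finally have 1: "dq l (sum_op ?I1 ?T1 F) n \<alpha> - sum_op ?I1 ?T1 (dq l F) n \<alpha>
      = of_int (l + m) * dq (l + m) F n \<alpha>" .
  have 2: "dq l (sum_op ?I2 ?T2 F) n \<alpha> - sum_op ?I2 ?T2 (dq l F) n \<alpha> = 0"
    by (subst sum_op_commutator_dq[OF finite_subset[OF _ L_finite_support(2)[of m]]])
      (auto simp: dq_scale scale_op_nth dq_dq[of l] sum.G_def intro!: sum.neutral)
  have 3: "dq l (sum_op ?I3 ?T3 F) n \<alpha> - sum_op ?I3 ?T3 (dq l F) n \<alpha> = 0"
    by (subst sum_op_commutator_dq[OF finite_subset[OF _ L_finite_support(3)[of m]]])
      (use assms in \<open>auto simp: dq_q sum.G_def q_add q_0 intro!: sum.neutral\<close>)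
  have "dq l (L m F) n \<alpha> - L m (dq l F) n \<alpha> =
     (dq l (sum_op ?I1 ?T1 F) n \<alpha> - sum_op ?I1 ?T1 (dq l F) n \<alpha>)
     + 1/2 * (dq l (sum_op ?I2 ?T2 F) n \<alpha> - sum_op ?I2 ?T2 (dq l F) n \<alpha>)
     + 1/2 * (dq l (sum_op ?I3 ?T3 F) n \<alpha> - sum_op ?I3 ?T3 (dq l F) n \<alpha>)"
    unfolding L_def by (simp only: dq_add dq_scale scale_op_nth plus_fun_apply) (simp only: algebra_simps)
  then show ?thesis by (simp only: 1 2 3) simp
qed

text \<open>The derivative removes one factor \<open>q\<close> from each cubic term. The three sums
  of \<open>M k\<close> have 2, 1 and 3 such factors; with the prefactors 1/2, 1/2 and 1/6 this
  gives 1, 1/2 and 1/2, the prefactors of the three sums of \<open>L (l + k)\<close>.\<close>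

lemma dq_M:
  fixes F :: "'a::field_char_0 ser"
  assumes "l > 0"
  shows "dq l (M k F) n \<alpha> - M k (dq l F) n \<alpha> = L (l + k) F n \<alpha>"
proof -
  let ?I1 = "{(i, j). i > 0 \<and> j > 0 \<and> i + j + k > 0}" and ?I2 = "{(i, j). i > 0 \<and> j > 0 \<and> i + j - k > 0}"
    and ?I3 = "{(i, j). i > 0 \<and> j > 0 \<and> - k - i - j > 0}"
  let ?T1 = "\<lambda>(i, j). of_int (i + j + k) \<odot> (q i \<circ> q j \<circ> dq (i + j + k)) :: 'a ser \<Rightarrow> 'a ser"
    and ?T2 = "\<lambda>(i, j). of_int (i * j) \<odot> (q (i + j - k) \<circ> dq i \<circ> dq j) :: 'a ser \<Rightarrow> 'a ser"
    and ?T3 = "\<lambda>(i, j). q i \<circ> q j \<circ> q (- k - i - j) :: 'a ser \<Rightarrow> 'a ser"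
  let ?J1 = "{j. j > 0 \<and> j + (l + k) > 0}" and ?J2 = "{(a, b). a > 0 \<and> b > 0 \<and> a + b = l + k}"
    and ?J3 = "{(i, j). i > 0 \<and> j > 0 \<and> i + j = - (l + k)}"
  let ?S1 = "\<lambda>k. of_int (k + (l + k)) \<odot> (q k \<circ> dq (k + (l + k))) :: 'a ser \<Rightarrow> 'a ser"
  let ?U1 = "\<lambda>j. (of_int (j + (l + k)) \<odot> (q j \<circ> dq (j + (l + k)))) F n \<alpha>"
    and ?U2 = "\<lambda>(a, b). (of_int (a * b) \<odot> (dq a \<circ> dq b)) F n \<alpha>"
    and ?U3 = "\<lambda>(i, j). q i (q j F) n \<alpha>"
  have fin3: "finite {p \<in> ?I3. f p \<noteq> 0}" for f :: "int \<times> int \<Rightarrow> 'a"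
    by (rule finite_subset[OF _ M_finite_support(3)[of k]]) auto

  have finU: "finite {j \<in> ?J1. ?U1 j \<noteq> 0}" by (rule L_finite_support)
  have three: "x + (x + x) = 3 * x" for x :: 'a by simp
  \<comment> \<open>In \<open>?A\<close> the factor \<open>q i\<close> is removed, in
    \<open>?B\<close> the factor \<open>q j\<close>. Each leaves the first sum of
    \<open>L (l + k)\<close>, indexed by the remaining factor.\<close>
  let ?A = "\<lambda>(i, j). if i = l then ?U1 j else 0" and ?B = "\<lambda>(i, j). if j = l then ?U1 i else 0"
  have finA: "finite {p \<in> ?I1. ?A p \<noteq> 0}"
    by (rule finite_subset[OF _ finite_imageI[OF finU, of "Pair l"]]) (auto split: if_splits simp: algebra_simps)
  have finB: "finite {p \<in> ?I1. ?B p \<noteq> 0}"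
    by (rule finite_subset[OF _ finite_imageI[OF finU, of "\<lambda>i. (i, l)"]]) (auto split: if_splits simp: algebra_simps)
  have "dq l (sum_op ?I1 ?T1 F) n \<alpha> - sum_op ?I1 ?T1 (dq l F) n \<alpha> = sum' (\<lambda>p. ?A p + ?B p) ?I1"
    by (subst sum_op_commutator_dq[OF M_finite_support(1)], rule sum.cong')
      (auto simp: dq_scale scale_op_nth dq_q dq_dq[of l] q_add q_0 algebra_simps)
  also have "\<dots> = sum' ?A ?I1 + sum' ?B ?I1" by (rule sum.distrib'[OF finA finB])
  also have "sum' ?A ?I1 = sum' ?U1 ?J1"
    by (rule sum'_reindex[where h = "Pair l"]) (use assms in \<open>auto simp: inj_on_def algebra_simps image_iff split: if_splits\<close>)
  also have "sum' ?B ?I1 = sum' ?U1 ?J1"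
    by (rule sum'_reindex[where h = "\<lambda>i. (i, l)"]) (use assms in \<open>auto simp: inj_on_def algebra_simps image_iff split: if_splits\<close>)
  finally have 1: "dq l (sum_op ?I1 ?T1 F) n \<alpha> - sum_op ?I1 ?T1 (dq l F) n \<alpha> = 2 * sum' ?U1 ?J1"
    by (simp only: mult_2)

  \<comment> \<open>Removing \<open>q (i + j - k)\<close> forces
    \<open>i + j = l + k\<close>.\<close>
  have "dq l (sum_op ?I2 ?T2 F) n \<alpha> - sum_op ?I2 ?T2 (dq l F) n \<alpha>
      = sum' (\<lambda>(i, j). if i + j = l + k then ?U2 (i, j) else 0) ?I2"
    by (subst sum_op_commutator_dq[OF M_finite_support(2)], rule sum.cong')
      (auto simp: dq_scale scale_op_nth dq_q dq_dq[of l] q_add q_0 algebra_simps)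
  also have "\<dots> = sum' ?U2 ?J2"
    by (rule sum'_reindex[where h = id]) (use assms in \<open>auto simp: algebra_simps image_iff split: if_splits\<close>)
  finally have 2: "dq l (sum_op ?I2 ?T2 F) n \<alpha> - sum_op ?I2 ?T2 (dq l F) n \<alpha> = sum' ?U2 ?J2" .

  \<comment> \<open>One sum for each of the three factors that can be removed. The two remaining
    subscripts are positive with sum \<open>- (l + k)\<close>, so each sum reindexes to
    \<open>?J3\<close>.\<close>
  let ?C = "\<lambda>(i, j). if i = l then q j (q (- k - i - j) F) n \<alpha> else 0"
    and ?D = "\<lambda>(i, j). if j = l then q i (q (- k - i - j) F) n \<alpha> else 0"
    and ?E = "\<lambda>(i, j). if - k - i - j = l then ?U3 (i, j) else 0"
  have "dq l (sum_op ?I3 ?T3 F) n \<alpha> - sum_op ?I3 ?T3 (dq l F) n \<alpha>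
      = sum' (\<lambda>p. ?C p + (?D p + ?E p)) ?I3"
    by (subst sum_op_commutator_dq[OF fin3], rule sum.cong')
      (auto simp: dq_q q_add q_0)
  also have "\<dots> = sum' ?C ?I3 + (sum' ?D ?I3 + sum' ?E ?I3)"
    by (simp only: sum.distrib'[OF fin3 fin3])
  also have "sum' ?C ?I3 = sum' ?U3 ?J3"
  proof (rule sum'_reindex[where h = "\<lambda>(i, j). (l, i)"])
    show "inj_on (\<lambda>(i, j). (l, i)) ?J3" by (auto simp: inj_on_def)
    show "(\<lambda>(i, j). (l, i)) ` ?J3 \<subseteq> ?I3" using assms by auto
    show "p \<in> (\<lambda>(i, j). (l, i)) ` ?J3" if "p \<in> ?I3" "?C p \<noteq> 0" for p
      using that by (intro image_eqI[of _ _ "(snd p, - k - l - snd p)"]) (auto split: if_splits)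
    show "?C ((\<lambda>(i, j). (l, i)) p) = ?U3 p" if "p \<in> ?J3" for p
    proof -
      have "- k - l - fst p = snd p" "- k - fst p - l = snd p" using that by auto
      then show ?thesis by (simp only: split_beta fst_conv snd_conv simp_thms if_True)
    qed
  qed
  also have "sum' ?D ?I3 = sum' ?U3 ?J3"
  proof (rule sum'_reindex[where h = "\<lambda>(i, j). (i, l)"])
    show "inj_on (\<lambda>(i, j). (i, l)) ?J3" by (auto simp: inj_on_def)
    show "(\<lambda>(i, j). (i, l)) ` ?J3 \<subseteq> ?I3" using assms by auto
    show "p \<in> (\<lambda>(i, j). (i, l)) ` ?J3" if "p \<in> ?I3" "?D p \<noteq> 0" for p
      using that by (intro image_eqI[of _ _ "(fst p, - k - l - fst p)"]) (auto split: if_splits)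
    show "?D ((\<lambda>(i, j). (i, l)) p) = ?U3 p" if "p \<in> ?J3" for p
    proof -
      have "- k - l - fst p = snd p" "- k - fst p - l = snd p" using that by auto
      then show ?thesis by (simp only: split_beta fst_conv snd_conv simp_thms if_True)
    qed
  qed
  also have "sum' ?E ?I3 = sum' ?U3 ?J3"
    by (rule sum'_reindex[where h = id]) (use assms in \<open>auto simp: algebra_simps image_iff split: if_splits\<close>)
  finally have 3: "dq l (sum_op ?I3 ?T3 F) n \<alpha> - sum_op ?I3 ?T3 (dq l F) n \<alpha> = 3 * sum' ?U3 ?J3"
    by (rule trans) (rule three)

  have "dq l (M k F) n \<alpha> - M k (dq l F) n \<alpha> =
     1/2 * (dq l (sum_op ?I1 ?T1 F) n \<alpha> - sum_op ?I1 ?T1 (dq l F) n \<alpha>)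
     + 1/2 * (dq l (sum_op ?I2 ?T2 F) n \<alpha> - sum_op ?I2 ?T2 (dq l F) n \<alpha>)
     + 1/6 * (dq l (sum_op ?I3 ?T3 F) n \<alpha> - sum_op ?I3 ?T3 (dq l F) n \<alpha>)"
    unfolding M_def by (simp only: dq_add dq_scale scale_op_nth plus_fun_apply) (simp only: algebra_simps)
  also have "\<dots> = sum' ?U1 ?J1 + 1/2 * sum' ?U2 ?J2 + 1/2 * sum' ?U3 ?J3"
    unfolding 1 2 3 by simp
  also have "\<dots> = L (l + k) F n \<alpha>"
    unfolding L_def by (simp add: sum_op_def scale_op_nth case_prod_unfold)
  finally show ?thesis .
qed

section \<open>Powers of \<open>eta\<close> and the coefficients \<open>nu\<close> and
  \<open>gamma\<close>\<close>

text \<open>Differentiating \<open>eta_square\<close>, the two terms 2/(1+z) cancel and 2z/(1+z)^2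
  remains on the right.\<close>

lemma eta_deriv: "(1 + fps_X)\<^sup>2 * (eta * fps_deriv eta) = (fps_X :: 'a::field_char_0 fps)"
proof -
  let ?I = "inverse (1 + fps_X) :: 'a fps"
  have I: "(1 + fps_X) * ?I = 1" by (rule inverse_mult_eq_1') simp
  have dI: "fps_deriv ?I = - ?I\<^sup>2"
    by (subst fps_inverse_deriv) simp_all
  have "fps_deriv ((eta :: 'a fps)\<^sup>2) = 2 * ?I - 2 * (?I + fps_X * fps_deriv ?I)"
    unfolding eta_square by (simp add: fps_divide_unit fps_ln_deriv fps_deriv_mult algebra_simps flip: numeral_fps_const)
  then have "2 * (eta * fps_deriv eta) = 2 * (fps_X * ?I\<^sup>2)"
    unfolding dI by (simp add: power2_eq_square algebra_simps)
  then have "(1 + fps_X)\<^sup>2 * (eta * fps_deriv eta) = fps_X * ((1 + fps_X) * ?I)\<^sup>2"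
    by (simp add: power_mult_distrib mult_ac)
  then show ?thesis unfolding I by simp
qed

text \<open>Read off in the Laurent series, so that it is 0 at negative indices: for
  \<open>m = 1\<close> the series defining \<open>nu (m - 2)\<close> starts at index -2.\<close>

abbreviation eta_coeff :: "nat \<Rightarrow> int \<Rightarrow> 'a::field_char_0" where
  "eta_coeff m j \<equiv> fls_nth (fps_to_fls (eta ^ (2 * m))) j"

text \<open>The chain rule followed by \<open>eta_deriv\<close>. The exponent 2m - 2 that results is
  the one in \<open>nu\<close> and \<open>gamma\<close> at index \<open>m - 2\<close>; for
  \<open>m \<ge> 1\<close> it is a natural number.\<close>

lemma fls_deriv_eta_power:
  assumes "m \<ge> 1"
  shows "(1 + fls_X)\<^sup>2 * fls_deriv (fps_to_fls (eta ^ (2 * m)))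
    = of_nat (2 * m) * (fls_X * fps_to_fls (eta :: 'a::field_char_0 fps) powi (2 * (int m - 2) + 2))"
proof -
  have e: "2 * (int m - 2) + 2 = int (2 * m - 2)" and e': "2 * m - 1 = Suc (2 * m - 2)" using assms by auto
  have "fps_deriv (eta ^ (2 * m)) = of_nat (2 * m) * ((eta :: 'a fps) ^ (2 * m - 2) * (eta * fps_deriv eta))"
    unfolding fps_deriv_power' by (simp only: e' power_Suc2 diff_Suc_1 mult.assoc mult.commute[of "fps_deriv eta"])
  then have "(1 + fps_X)\<^sup>2 * fps_deriv (eta ^ (2 * m))
      = of_nat (2 * m) * ((1 + fps_X)\<^sup>2 * (eta * fps_deriv eta) * (eta :: 'a fps) ^ (2 * m - 2))"
    by (simp only: mult_ac)
  then have "fps_to_fls ((1 + fps_X)\<^sup>2 * fps_deriv (eta ^ (2 * m)))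
      = fps_to_fls (of_nat (2 * m) * (fps_X * (eta :: 'a fps) ^ (2 * m - 2)))"
    unfolding eta_deriv by (rule arg_cong)
  then show ?thesis
    unfolding e power_int_of_nat fls_deriv_fps_to_fls
    by (simp add: fls_times_fps_to_fls fps_to_fls_power)
qed

text \<open>With f = eta^(2m), the series of \<open>nu (m - 2)\<close> times 2m is (1+z)^4 f'/z^3.
  The binomial coefficients 1, 4, 6, 4, 1 are those of \<open>M 0\<close> to \<open>M (-4)\<close>
  in \<open>Mtilde\<close>.\<close>

lemma nu_eq:
  assumes "m \<ge> 1"
  shows "of_nat (2 * m) * nu (int m - 2) i = (of_int i * eta_coeff m i + 4 * (of_int (i + 1) * eta_coeff m (i + 1))
    + 6 * (of_int (i + 2) * eta_coeff m (i + 2)) + 4 * (of_int (i + 3) * eta_coeff m (i + 3))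
    + of_int (i + 4) * eta_coeff m (i + 4) :: 'a::field_char_0)"
proof -
  define D where "D = fls_deriv (fps_to_fls ((eta :: 'a fps) ^ (2 * m)))"
  define P where "P = fps_to_fls (eta :: 'a fps) powi (2 * (int m - 2) + 2)"
  define S where "S = (1 + fls_X)\<^sup>2 / fls_X\<^sup>2 * P"
  have cancel: "x ^ 3 * (k * ((1 + x)\<^sup>2 / x\<^sup>2 * p)) = (1 + x)\<^sup>2 * (k * (x * p))"
    if "x \<noteq> 0" for x k p :: "'a fls"
    using that by (simp add: power2_eq_square power3_eq_cube)
  have expand: "(1 + x)\<^sup>2 * ((1 + x)\<^sup>2 * d) = d + 4 * (x * d) + 6 * (x ^ 2 * d) + 4 * (x ^ 3 * d) + x ^ 4 * d"
    for x d :: "'a fls"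
    by (simp add: power2_eq_square power3_eq_cube power4_eq_xxxx algebra_simps)
  \<comment> \<open>The factor z^3 turns (1+z)^2/z^2 into z (1+z)^2, the form in which
    \<open>fls_deriv_eta_power\<close> applies. Hence the comparison at index
    \<open>i + 3\<close>.\<close>
  have "fls_X ^ 3 * (of_nat (2 * m) * S) = (1 + fls_X)\<^sup>2 * (of_nat (2 * m) * (fls_X * P))"
    unfolding S_def by (rule cancel) simp
  also have "\<dots> = (1 + fls_X)\<^sup>2 * ((1 + fls_X)\<^sup>2 * D)"
    unfolding P_def D_def fls_deriv_eta_power[OF assms] ..
  also have "\<dots> = D + 4 * (fls_X * D) + 6 * (fls_X ^ 2 * D) + 4 * (fls_X ^ 3 * D) + fls_X ^ 4 * D"
    by (rule expand)
  finally have "fls_nth (fls_X ^ 3 * (of_nat (2 * m) * S)) (i + 3)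
      = fls_nth (D + 4 * (fls_X * D) + 6 * (fls_X ^ 2 * D) + 4 * (fls_X ^ 3 * D) + fls_X ^ 4 * D) (i + 3)"
    by (rule arg_cong)
  then have "of_nat (2 * m) * fls_nth S i
      = fls_nth D (i + 3) + 4 * fls_nth D (i + 2) + 6 * fls_nth D (i + 1) + 4 * fls_nth D i + fls_nth D (i - 1)"
    by (simp add: fls_X_power_times_conv_shift fls_X_times_conv_shift add.commute[of _ i] del: of_nat_mult)
  also have "\<dots> = of_int i * eta_coeff m i + 4 * (of_int (i + 1) * eta_coeff m (i + 1))
    + 6 * (of_int (i + 2) * eta_coeff m (i + 2)) + 4 * (of_int (i + 3) * eta_coeff m (i + 3))
    + of_int (i + 4) * eta_coeff m (i + 4)"
    by (simp add: D_def add.commute[of _ i] del: of_int_add fps_to_fls_nth)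
  finally show ?thesis
    unfolding nu_def P_def[symmetric] S_def[symmetric] .
qed

text \<open>With f = eta^(2m), the series of \<open>gamma (m - 2)\<close> times 2m is -(1+z) f',
  since one factor 1+z cancels.\<close>

lemma gamma_eq:
  assumes "m \<ge> 1"
  shows "of_nat (2 * m) * gamma (int m - 2) j
    = - (of_int j * eta_coeff m j + of_int (j + 1) * eta_coeff m (j + 1) :: 'a::field_char_0)"
proof -
  define D where "D = fls_deriv (fps_to_fls ((eta :: 'a fps) ^ (2 * m)))"
  define P where "P = fps_to_fls (eta :: 'a fps) powi (2 * (int m - 2) + 2)"
  have nz: "1 + fls_X \<noteq> (0 :: 'a fls)"
    by (rule fls_nonzeroI[where n = 0]) simp
  define S where "S = - (fls_X / (1 + fls_X)) * P"
  have "of_nat (2 * m) * S = - (of_nat (2 * m) * (fls_X * P)) / (1 + fls_X)"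
    unfolding S_def by (simp only: times_divide_eq_left times_divide_eq_right mult_minus_left mult_minus_right minus_divide_left)
  also have "\<dots> = - ((1 + fls_X) * D)"
    unfolding P_def D_def fls_deriv_eta_power[OF assms, symmetric] using nz by (simp add: power2_eq_square)
  also have "\<dots> = - (D + fls_X * D)" by (simp add: algebra_simps)
  finally have "fls_nth (of_nat (2 * m) * S) j = fls_nth (- (D + fls_X * D)) j"
    by (rule arg_cong)
  then show ?thesis
    unfolding gamma_def P_def[symmetric] S_def[symmetric] by (simp add: D_def fls_X_times_conv_shift del: of_nat_mult)
qed

text \<open>\<open>eta\<close> is z times a series with constant term 1; order and leading
  coefficient of its powers follow.\<close>

lemma eta_power: "\<exists>h :: 'a::field_char_0 fps. fps_nth h 0 = 1 \<and> eta ^ k = fps_X ^ k * h ^ k"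
proof -
  have "fps_nth ((eta :: 'a fps)\<^sup>2) 0 = 0"
    unfolding eta_square by (simp add: fps_divide_unit)
  then have e0: "fps_nth (eta :: 'a fps) 0 = 0" by (simp add: fps_power_zeroth)
  have h: "eta = fps_X * fps_shift 1 (eta :: 'a fps)"
    by (rule fps_ext) (simp add: e0)
  have "eta ^ k = fps_X ^ k * fps_shift 1 (eta :: 'a fps) ^ k"
    using arg_cong[OF h, of "\<lambda>f. f ^ k"] by (simp only: power_mult_distrib)
  then show ?thesis using eta_nth_1[where ?'a = 'a] by (intro exI[of _ "fps_shift 1 eta"]) simp
qed

lemma eta_coeff_less: "j < 2 * int m \<Longrightarrow> eta_coeff m j = (0 :: 'a::field_char_0)"
  using eta_power[of "2 * m", where 'a = 'a] by (auto simp: fps_X_power_mult_nth)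

lemma eta_coeff_lead: "eta_coeff m (2 * int m) = (1 :: 'a::field_char_0)"
  using eta_power[of "2 * m", where 'a = 'a] by (auto simp: fps_X_power_mult_nth fps_power_zeroth nat_mult_distrib)

lemma eta_coeff_1: "eta_coeff 1 3 = (- 4/3 :: 'a::field_char_0)" "eta_coeff 1 4 = (3/2 :: 'a)"
proof -
  have inv: "inverse (1 + fps_X :: 'a fps) = Abs_fps (\<lambda>n. (- 1) ^ n)"
    by (rule fps_inverse_fps_X_plus1)
  have "fps_nth (2 * fps_ln 1 - 2 * fps_X / (1 + fps_X)) n
      = 2 * fps_nth (fps_ln 1) n - 2 * (if n = 0 then 0 else (- 1) ^ (n - 1) :: 'a)" for n
    by (simp add: fps_divide_unit mult.assoc fps_X_mult_nth inv numeral_fps_const)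
  then show "eta_coeff 1 3 = (- 4/3 :: 'a)" "eta_coeff 1 4 = (3/2 :: 'a)"
    by (simp_all add: eta_square fps_ln_nth)
qed

text \<open>On the left stands the contribution of the terms \<open>q 2\<close>, \<open>q 3\<close>,
  \<open>q 4\<close> of \<open>Mtilde\<close>: their coefficients 1/4, 1/3, 1/8 times the subscript
  are 1/2, 1, 1/2. As eta^(2m) has order 2m, it vanishes for \<open>m > 2\<close> and only index 4
  counts for \<open>m = 2\<close>. For \<open>m = 1\<close> it is (1/2 - 4/3 + 3/4)/2 =
  -1/24.\<close>

lemma central_coeff:
  assumes "m \<ge> 1"
  shows "(eta_coeff m 2 / 2 + eta_coeff m 3 + eta_coeff m 4 / 2) / of_nat (2 * m)
    = (- (if int m - 2 = -1 then 1/24 else 0) + (if int m - 2 = 0 then 1/8 else 0) :: 'a::field_char_0)"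
proof -
  consider "m = 1" | "m = 2" | "m > 2" using assms by linarith
  then show ?thesis
  proof cases
    case 1
    have "eta_coeff 1 2 = (1 :: 'a)" using eta_coeff_lead[of 1, where 'a = 'a] by simp
    with 1 show ?thesis by (simp only: eta_coeff_1) simp
  next
    case 2
    then show ?thesis
      using eta_coeff_lead[of 2, where 'a = 'a] eta_coeff_less[of 2 2, where 'a = 'a]
        eta_coeff_less[of 3 2, where 'a = 'a] by simp
  next
    case 3
    then show ?thesis
      using eta_coeff_less[of 2 m, where 'a = 'a] eta_coeff_less[of 3 m, where 'a = 'a]
        eta_coeff_less[of 4 m, where 'a = 'a] by simp
  qed
qed

section \<open>The commutator with a single term u^j \<open>dq j\<close>\<close>

lemma upow_commute:
  fixes F :: "'a::field_char_0 ser"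
  shows "L m (upow r F) = upow r (L m F)" "M k (upow r F) = upow r (M k F)"
    "q i (upow r F) = upow r (q i F)" "dq i (upow r F) = upow r (dq i F)"
  by (simp_all add: fun_eq_iff L_def M_def sum_op_def scale_op_def q_def dq_def upow_def case_prod_unfold)

lemma upow_nth: "upow r F n \<alpha> = F (n - r) \<alpha>"
  by (simp add: upow_def)

lemma commutator_nth: "\<lbrakk>A, B\<rbrakk> F n \<alpha> = A (B F) n \<alpha> - B (A F) n \<alpha>"
  by (simp add: commutator_def)

text \<open>The terms \<open>M k\<close> give the \<open>L (j + k)\<close> by \<open>dq_M\<close>,
  and the terms \<open>q i\<close> give the constants. The coefficient of \<open>dq j\<close> is
  4j/3 from \<open>L 0\<close> minus j/3 from the derivative in u. \<open>L (-1)\<close> gives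
  \<open>dq (j - 1)\<close>; \<open>j \<ge> 2\<close> keeps this subscript positive, as
  \<open>dq_L\<close> requires.\<close>

lemma commutator_Mtilde_dq:
  fixes F :: "'a::field_char_0 ser"
  assumes "j \<ge> 2"
  defines "W \<equiv> Mtilde - (1/3) \<odot> (upow (-2) \<circ> du)"
  shows "W (upow j (dq j F)) n \<alpha> - dq j (W F) (n - j) \<alpha> =
    - (L j F (n - j) \<alpha> + 4 * L (j - 1) F (n + 1 - j) \<alpha> + 6 * L (j - 2) F (n + 2 - j) \<alpha>
       + 4 * L (j - 3) F (n + 3 - j) \<alpha> + L (j - 4) F (n + 4 - j) \<alpha>)
    + of_int j * dq j F (n + 3 - j) \<alpha> + of_int (j - 1) * dq (j - 1) F (n + 4 - j) \<alpha>
    - (if j = 2 then 1/4 else if j = 3 then 1/3 else if j = 4 then 1/8 else 0) * F n \<alpha>"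
proof -
  have j: "j > 0" "j + 0 > 0" "j + - 1 > 0" using assms by auto
  have M: "M k (dq j F) n \<alpha> = dq j (M k F) n \<alpha> - L (j + k) F n \<alpha>" for k n \<alpha>
    using dq_M[OF j(1), of k F n \<alpha>] by (simp add: algebra_simps)
  have L: "L k (dq j F) n \<alpha> = dq j (L k F) n \<alpha> - of_int (j + k) * dq (j + k) F n \<alpha>" if "j + k > 0" for k n \<alpha>
    using dq_L[OF j(1) that, of F n \<alpha>] by (simp add: algebra_simps)
  \<comment> \<open>The derivative in u has weight \<open>n + 3\<close> here, but
    \<open>n - j + 3\<close> in \<open>W3\<close> taken at \<open>n - j\<close>; the difference
    \<open>j\<close> is the bracket of d/du with u^j.\<close>
  have W1: "W (upow j G) n \<alpha> = M 0 G (n - j) \<alpha> + 4 * M (-1) G (n + 1 - j) \<alpha> + 6 * M (-2) G (n + 2 - j) \<alpha>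
      + 4 * M (-3) G (n + 3 - j) \<alpha> + M (-4) G (n + 4 - j) \<alpha>
      - 4/3 * L 0 G (n + 3 - j) \<alpha> - L (-1) G (n + 4 - j) \<alpha>
      + 1/4 * q 2 G (n + 2 - j) \<alpha> + 1/3 * q 3 G (n + 3 - j) \<alpha> + 1/8 * q 4 G (n + 4 - j) \<alpha>
      - 1/3 * (of_int (n + 3) * G (n + 3 - j) \<alpha>)" for G n \<alpha>
    unfolding W_def Mtilde_def op_apply_nth scale_op_nth comp_apply upow_commute upow_nth du_def by (simp add: algebra_simps)
  have W2: "W F n \<alpha> = M 0 F n \<alpha> + 4 * M (-1) F (n + 1) \<alpha> + 6 * M (-2) F (n + 2) \<alpha>
      + 4 * M (-3) F (n + 3) \<alpha> + M (-4) F (n + 4) \<alpha>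
      - 4/3 * L 0 F (n + 3) \<alpha> - L (-1) F (n + 4) \<alpha>
      + 1/4 * q 2 F (n + 2) \<alpha> + 1/3 * q 3 F (n + 3) \<alpha> + 1/8 * q 4 F (n + 4) \<alpha>
      - 1/3 * (of_int (n + 3) * F (n + 3) \<alpha>)" for n \<alpha>
    unfolding W_def Mtilde_def op_apply_nth scale_op_nth comp_apply upow_nth du_def by (simp add: algebra_simps)
  have W3: "dq j (W F) n \<alpha> = dq j (M 0 F) n \<alpha> + 4 * dq j (M (-1) F) (n + 1) \<alpha> + 6 * dq j (M (-2) F) (n + 2) \<alpha>
      + 4 * dq j (M (-3) F) (n + 3) \<alpha> + dq j (M (-4) F) (n + 4) \<alpha>
      - 4/3 * dq j (L 0 F) (n + 3) \<alpha> - dq j (L (-1) F) (n + 4) \<alpha>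
      + 1/4 * dq j (q 2 F) (n + 2) \<alpha> + 1/3 * dq j (q 3 F) (n + 3) \<alpha> + 1/8 * dq j (q 4 F) (n + 4) \<alpha>
      - 1/3 * (of_int (n + 3) * dq j F (n + 3) \<alpha>)" for n \<alpha>
    unfolding dq_def W2 by (simp only: distrib_left right_diff_distrib mult.left_commute)
  have e: "n - j + k = n + k - j" for k by simp
  show ?thesis
    unfolding W1 W3 M L[OF j(2)] L[OF j(3)] dq_q e
    using j by (simp add: algebra_simps)
qed

section \<open>Truncation of the infinite sums\<close>

text \<open>Brings sums with different shifts \<open>r\<close> to one common range, so that their
  coefficients can be added. The extra terms vanish, at the lower end because of \<open>c\<close>
  and at the upper end because of \<open>g\<close>.\<close>

lemma sum_shift_coeff:
  fixes c g :: "int \<Rightarrow> 'a::field_char_0"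
  assumes "0 \<le> r" "r \<le> k" "\<And>j. j < lo \<Longrightarrow> c j = 0" "\<And>i. hi - k < i \<Longrightarrow> g i = 0"
  shows "(\<Sum>j=lo..hi. c j * g (j - r)) = (\<Sum>i=lo-k..hi. c (i + r) * g i)"
proof -
  have "(\<Sum>j=lo..hi. c j * g (j - r)) = (\<Sum>i=lo-r..hi-r. c (i + r) * g i)"
    by (rule sum.reindex_bij_witness[of _ "\<lambda>i. i + r" "\<lambda>j. j - r"]) auto
  also have "\<dots> = (\<Sum>i=lo-k..hi. c (i + r) * g i)"
    by (rule sum.mono_neutral_left) (use assms in auto)
  finally show ?thesis .
qed

lemma series_from_nth_0: "F \<in> series_from N \<Longrightarrow> n < N \<Longrightarrow> F n \<alpha> = 0"
  by (simp add: series_from_def)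

text \<open>A term with \<open>j > B\<close> reads a coefficient of u-order below \<open>N\<close>.
  Leaving \<open>B\<close> free allows the same range for \<open>F\<close> and for its image under
  the other operator.\<close>

lemma upow_E_nth:
  fixes G :: "'a::field_char_0 ser"
  assumes "G \<in> series_from N" "B \<ge> n - N"
  shows "(upow (2 * int m) \<circ> E m) G n \<alpha>
    = (\<Sum>j=2*int m..B. (eta_coeff m j * of_int j) * dq j G (n - j) \<alpha>)"
proof -
  have "dq j G (n - j) \<alpha> = 0" if "j > B" for j
    by (rule series_from_nth_0[OF dq_series_from[OF assms(1)]]) (use that assms(2) in simp)
  then have "(upow (2 * int m) \<circ> E m) G n \<alpha>
    = (\<Sum>j=2*int m..B. (fps_nth (eta ^ (2 * m)) (nat j) * of_int j) * dq j G (n - j) \<alpha>)"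
    unfolding E_def comp_apply upow_nth sum_op_def
    by (subst sum'_eq_sum[where J = "{2 * int m..B}"]) (auto simp: scale_op_nth upow_nth)
  also have "\<dots> = (\<Sum>j=2*int m..B. (eta_coeff m j * of_int j) * dq j G (n - j) \<alpha>)"
    by (rule sum.cong) auto
  finally show ?thesis .
qed

lemma V_nth:
  fixes F :: "'a::field_char_0 ser"
  assumes "F \<in> series_from N" "B \<ge> n + 2 * m + 3 - N"
  shows "V m F n \<alpha> = (\<Sum>i=2*m..B. nu m i * L i F (n + 2 * m - i) \<alpha>)
     + (\<Sum>j=2*m+3..B. gamma m j * (of_int j * dq j F (n + 2 * m + 3 - j) \<alpha>))
     + (- (if m = -1 then 1/24 else 0) + (if m = 0 then 1/8 else 0)) * F (n + 2 * m) \<alpha>"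
proof -
  have "L i F (n + 2 * m - i) \<alpha> = 0" if "i > B" for i
    by (rule series_from_nth_0[OF L_series_from[OF assms(1)]]) (use that assms(2) in simp)
  then have 1: "sum_op {2 * m..} (\<lambda>i. nu m i \<odot> (upow (i - 2 * m) \<circ> L i)) F n \<alpha>
      = (\<Sum>i=2*m..B. nu m i * L i F (n + 2 * m - i) \<alpha>)"
    unfolding sum_op_def
    by (subst sum'_eq_sum[where J = "{2 * m..B}"]) (auto simp: scale_op_nth upow_nth algebra_simps)
  have "dq j F (n + 2 * m + 3 - j) \<alpha> = 0" if "j > B" for j
    by (rule series_from_nth_0[OF dq_series_from[OF assms(1)]]) (use that assms(2) in simp)
  then have 2: "sum_op {2 * m + 3..} (\<lambda>j. (gamma m j * of_int j) \<odot> (upow (j - 2 * m - 3) \<circ> dq j)) F n \<alpha>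
      = (\<Sum>j=2*m+3..B. gamma m j * (of_int j * dq j F (n + 2 * m + 3 - j) \<alpha>))"
    unfolding sum_op_def
    by (subst sum'_eq_sum[where J = "{2 * m + 3..B}"]) (auto simp: scale_op_nth upow_nth algebra_simps)
  show ?thesis
    unfolding V_def op_apply_nth 1 2 by (simp add: scale_op_nth upow_nth)
qed

section \<open>Comparison of the coefficients at a fixed power of u\<close>

theorem proposition5:
  fixes m :: nat and F :: "'a::field_char_0 ser"
  assumes "m \<ge> 1" and "F \<in> series"
  shows "V (int m - 2) F =
    ((- 1 / (2 * of_nat m)) \<odot> (upow (4 - 2 * int m) \<circ>
       \<lbrakk>Mtilde - (1/3) \<odot> (upow (-2) \<circ> du), upow (2 * int m) \<circ> E m\<rbrakk>)) F"
proof (intro ext)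
  fix n \<alpha>
  obtain N where N: "F \<in> series_from N" using assms(2) by (auto simp: series_def)
  \<comment> \<open>The coefficient of u^n after multiplication by u^(4-2m) is the coefficient of
    u^p of the commutator.\<close>
  define p where "p = n + 2 * int m - 4"
  \<comment> \<open>The bound leaves room for the lower order \<open>N - 4\<close> of
    \<open>?W F\<close>, for the coefficients of \<open>?X F\<close> up to u^(p+4), and for index
    shifts by up to 4. The second entry makes \<open>B\<close> at least 4.\<close>
  define B where "B = max (p - N + 8) (2 * int m + 4)"
  have B: "B \<ge> p - N + 8" "B \<ge> 2 * int m + 4" by (simp_all add: B_def)
  let ?W = "Mtilde - (1/3) \<odot> (upow (-2) \<circ> du) :: 'a ser \<Rightarrow> 'a ser"
  let ?X = "upow (2 * int m) \<circ> E m :: 'a ser \<Rightarrow> 'a ser"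
  define c where "c j = (eta_coeff m j * of_int j :: 'a)" for j
  define l where "l i = L i F (p - i) \<alpha>" for i
  define d where "d i = of_int i * dq i F (p + 3 - i) \<alpha>" for i
  let ?b = "\<lambda>j::int. if j = 2 then 1/4 else if j = 3 then 1/3 else if j = 4 then 1/8 else 0 :: 'a"
  let ?J = "{2 * int m..B}"
  have c0: "c j = 0" if "j < 2 * int m" for j
    unfolding c_def eta_coeff_less[OF that] by simp
  have l0: "l i = 0" if "B - 4 < i" for i
    unfolding l_def by (rule series_from_nth_0[OF L_series_from[OF N]]) (use that B in simp)
  have d0: "d i = 0" if "B - 1 < i" for i
  proof -
    have "dq i F (p + 3 - i) \<alpha> = 0"
      by (rule series_from_nth_0[OF dq_series_from[OF N]]) (use that B in simp)
    then show ?thesis by (simp add: d_def)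
  qed

  have W: "linear_op ?W" by (intro linear_op_intros linear_op_Mtilde)
  have W_from: "?W G \<in> series_from (K - 4)" if "G \<in> series_from K" for G K
    unfolding op_apply comp_apply
    by (intro diff_series_from Mtilde_series_from scale_op_series_from that)
      (simp add: upow_series_from_ge[OF du_series_from[OF that]])

  \<comment> \<open>\<open>S\<close> is the finite part of \<open>?X F\<close>. The rest has order
    at least \<open>p + 5\<close>, so its image under \<open>?W\<close> has order at least
    \<open>p + 1\<close> and does not reach u^p.\<close>
  define S where "S = (\<Sum>j\<in>?J. (c j \<odot> (upow j \<circ> dq j)) F)"
  have S_nth: "S n \<alpha> = (\<Sum>j\<in>?J. c j * dq j F (n - j) \<alpha>)" for n \<alpha>
  proof -
    have "(\<Sum>j\<in>J. (c j \<odot> (upow j \<circ> dq j)) F) n \<alpha> = (\<Sum>j\<in>J. c j * dq j F (n - j) \<alpha>)" for J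
      by (induction J rule: infinite_finite_induct) (simp_all add: scale_op_nth upow_nth)
    then show ?thesis by (simp add: S_def)
  qed
  have XF: "?X F n \<alpha> = (\<Sum>j\<in>?J. c j * dq j F (n - j) \<alpha>)" if "n < p + 5" for n \<alpha>
    unfolding c_def by (rule upow_E_nth[OF N]) (use B(1) that in simp)
  have "?X F \<in> series_from N"
    unfolding comp_apply by (rule upow_series_from_ge[OF E_series_from[OF N]]) simp
  moreover have "dq j F n \<alpha> = 0" if "\<not> Poly_Mapping.keys \<alpha> \<subseteq> {0<..}" for j n \<alpha>
    using dq_series_from[OF N, of j] that by (simp add: series_from_def)
  ultimately have R: "?X F - S \<in> series_from (p + 5)"
    using XF by (auto simp: series_from_def S_nth simp del: comp_apply)
  have WS: "?W S p \<alpha> = (\<Sum>j\<in>?J. c j * ?W (upow j (dq j F)) p \<alpha>)"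
  proof -
    have "?W ((c j \<odot> (upow j \<circ> dq j)) F) = (\<lambda>n \<alpha>. c j * ?W (upow j (dq j F)) n \<alpha>)" for j
      using W unfolding linear_op_def scale_op_def comp_apply by blast
    then have "?W S = (\<Sum>j\<in>?J. (\<lambda>n \<alpha>. c j * ?W (upow j (dq j F)) n \<alpha>))"
      unfolding S_def linear_op_sum[OF W] by (simp only:)
    moreover have "(\<Sum>j\<in>J. (\<lambda>n \<alpha>. f j n \<alpha>)) p \<alpha> = (\<Sum>j\<in>J. f j p \<alpha>)" for J and f :: "int \<Rightarrow> 'a ser"
      by (induction J rule: infinite_finite_induct) simp_all
    ultimately show ?thesis by (simp only:)
  qed
  have "?X F = S + (?X F - S)" by simp
  then have "?W (?X F) = ?W S + ?W (?X F - S)"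
    using W unfolding linear_op_def by metis
  then have "?W (?X F) p \<alpha> = ?W S p \<alpha>"
    using series_from_nth_0[OF W_from[OF R], of p \<alpha>] by (simp only: plus_fun_apply) simp
  moreover have "?X (?W F) p \<alpha> = (\<Sum>j\<in>?J. c j * dq j (?W F) (p - j) \<alpha>)"
    unfolding c_def by (rule upow_E_nth[OF W_from[OF N]]) (use B in simp)
  ultimately have "\<lbrakk>?W, ?X\<rbrakk> F p \<alpha> = (\<Sum>j\<in>?J. c j * (?W (upow j (dq j F)) p \<alpha> - dq j (?W F) (p - j) \<alpha>))"
    unfolding commutator_nth WS by (simp only: sum_subtractf right_diff_distrib)
  \<comment> \<open>The unshifted terms are written with \<open>j - 0\<close> to match
    \<open>sum_shift_coeff\<close> at \<open>r = 0\<close>.\<close>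
  also have "\<dots> = (\<Sum>j\<in>?J. - (c j * l (j - 0) + 4 * (c j * l (j - 1)) + 6 * (c j * l (j - 2))
      + 4 * (c j * l (j - 3)) + c j * l (j - 4))
      + (c j * d (j - 0) + c j * d (j - 1)) - c j * ?b j * F p \<alpha>)"
  proof (rule sum.cong[OF refl])
    fix j assume "j \<in> ?J"
    then have "j \<ge> 2" using assms(1) by simp
    note eq = commutator_Mtilde_dq[OF this, of F p \<alpha>]
    show "c j * (?W (upow j (dq j F)) p \<alpha> - dq j (?W F) (p - j) \<alpha>) =
      - (c j * l (j - 0) + 4 * (c j * l (j - 1)) + 6 * (c j * l (j - 2))
      + 4 * (c j * l (j - 3)) + c j * l (j - 4))
      + (c j * d (j - 0) + c j * d (j - 1)) - c j * ?b j * F p \<alpha>"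
      unfolding eq l_def d_def by (simp add: algebra_simps)
  qed
  also have "\<dots> = - ((\<Sum>j\<in>?J. c j * l (j - 0)) + 4 * (\<Sum>j\<in>?J. c j * l (j - 1))
      + 6 * (\<Sum>j\<in>?J. c j * l (j - 2)) + 4 * (\<Sum>j\<in>?J. c j * l (j - 3)) + (\<Sum>j\<in>?J. c j * l (j - 4)))
      + ((\<Sum>j\<in>?J. c j * d (j - 0)) + (\<Sum>j\<in>?J. c j * d (j - 1))) - (\<Sum>j\<in>?J. c j * ?b j) * F p \<alpha>"
    by (simp only: sum.distrib sum_subtractf sum_negf sum_distrib_left sum_distrib_right)
  \<comment> \<open>\<open>c\<close> vanishes below 2m, so the range may be extended down to 2;
    there only the subscripts of \<open>q 2\<close>, \<open>q 3\<close> and \<open>q 4\<close>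
    contribute.\<close>
  also have "(\<Sum>j\<in>?J. c j * ?b j) = (\<Sum>j\<in>{2, 3, 4}. c j * ?b j)"
  proof -
    have "(\<Sum>j\<in>?J. c j * ?b j) = (\<Sum>j\<in>{2..B}. c j * ?b j)"
      by (rule sum.mono_neutral_left) (use assms(1) in \<open>auto simp: c0\<close>)
    also have "\<dots> = (\<Sum>j\<in>{2, 3, 4}. c j * ?b j)"
      by (rule sum.mono_neutral_right) (use assms(1) B in auto)
    finally show ?thesis .
  qed
  also have "\<dots> = eta_coeff m 2 / 2 + eta_coeff m 3 + eta_coeff m 4 / 2"
    by (simp add: c_def)
  finally have comm: "\<lbrakk>?W, ?X\<rbrakk> F p \<alpha> =
      - (\<Sum>i=2*int m-4..B. (c i + 4 * c (i + 1) + 6 * c (i + 2) + 4 * c (i + 3) + c (i + 4)) * l i)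
      + (\<Sum>j=2*int m-1..B. (c j + c (j + 1)) * d j)
      - (eta_coeff m 2 / 2 + eta_coeff m 3 + eta_coeff m 4 / 2) * F p \<alpha>"
    by (simp only: sum_shift_coeff[of _ 4 "2 * int m" c B l, OF _ _ c0 l0]
        sum_shift_coeff[of _ 1 "2 * int m" c B d, OF _ _ c0 d0])
      (simp only: sum.distrib distrib_right sum_distrib_left mult.assoc add_0_right)

  define k where "k = (of_nat (2 * m) :: 'a)"
  have k: "k \<noteq> 0" unfolding k_def using assms(1) by simp
  have nu: "nu (int m - 2) i = (c i + 4 * c (i + 1) + 6 * c (i + 2) + 4 * c (i + 3) + c (i + 4)) / k" for i
  proof -
    have "k * nu (int m - 2) i = c i + 4 * c (i + 1) + 6 * c (i + 2) + 4 * c (i + 3) + c (i + 4)"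
      unfolding k_def c_def nu_eq[OF assms(1)] by (simp only: mult.commute)
    then show ?thesis using k by (simp add: field_simps)
  qed
  have gamma: "gamma (int m - 2) j = - ((c j + c (j + 1)) / k)" for j
  proof -
    have "k * gamma (int m - 2) j = - (c j + c (j + 1))"
      unfolding k_def c_def gamma_eq[OF assms(1)] by (simp only: mult.commute)
    then show ?thesis using k by (simp add: field_simps)
  qed
  have p: "n + 2 * (int m - 2) = p" "2 * (int m - 2) = 2 * int m - 4" "2 * (int m - 2) + 3 = 2 * int m - 1"
    by (simp_all add: p_def)
  have Vn: "V (int m - 2) F n \<alpha> = (\<Sum>i=2*int m-4..B. nu (int m - 2) i * l i)
     + (\<Sum>j=2*int m-1..B. gamma (int m - 2) j * d j)
     + (eta_coeff m 2 / 2 + eta_coeff m 3 + eta_coeff m 4 / 2) / k * F p \<alpha>"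
    using V_nth[OF N, of n "int m - 2" B \<alpha>] B(1)
    unfolding p(1,3) central_coeff[OF assms(1), symmetric] k_def[symmetric]
    unfolding p(2) l_def d_def by simp
  have lin: "A / k + - (C / k) + D * x / k = - 1 * (- A + C - D * x) / k" for A C D x
    by (simp add: algebra_simps diff_divide_distrib add_divide_distrib)
  have "V (int m - 2) F n \<alpha> = - 1 / k * (\<lbrakk>?W, ?X\<rbrakk> F p \<alpha>)"
    unfolding Vn comm by (simp only: nu gamma mult_minus_left sum_negf times_divide_eq_left
        sum_divide_distrib[symmetric] lin)
  moreover have "n - (4 - 2 * int m) = p" by (simp add: p_def)
  ultimately show "V (int m - 2) F n \<alpha> = ((- 1 / (2 * of_nat m)) \<odot> (upow (4 - 2 * int m) \<circ> \<lbrakk>?W, ?X\<rbrakk>)) F n \<alpha>"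
    unfolding scale_op_nth comp_apply[of "upow _"] upow_nth k_def by simp
qed

end
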